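(* Let $X$ be a pointed metric space, $E$ a Banach space and $\alpha$ a Lipschitz cross-norm on $X\boxtimes E$. Then $\mathrm{Lip}_\alpha(X,E^* )$ (with the norm $\mathrm{Lip}_\alpha$) is a Lipschitz operator Banach space if and only if $\alpha$ is dualizable.
   Context: $\mathbb{K}$ is $\mathbb R$ or $\mathbb C$. A pointed metric space $X$ is a metric space with metric $d$ and a designated base point $0$; a normed space is pointed by its zero vector. For a Banach space $F$, $\mathrm{Lip}_0(X,F)$ is the space of base-point preserving Lipschitz maps $X\to F$, with norm $\mathrm{Lip}$ (least Lipschitz constant); $X^\#=\mathrm{Lip}_0(X,\mathbb K)$; $E^*$ is the topological dual. The Lipschitz tensor product $X\boxtimes E$ is the linear span of all linear functionals $\delta_{(x,y)}\boxtimes e$ on $\mathrm{Lip}_0(X,E^* )$ of the form $(\delta_{(x,y)}\boxtimes e)(f)=\langle f(x)-f(y),e\rangle$, for $x,y\in X$ and $e\in E$. A norm $\alpha$ on $X\boxtimes E$ is a Lipschitz cross-norm if $\alpha(\delta_{(x,y)}\boxtimes e)=d(x,y)\|e\|$ always. It is dualizable if $\left|\sum_{i=1}^n(g(x_i)-g(y_i))\langle\phi,e_i\rangle\right|\le\mathrm{Lip}(g)\|\phi\|\,\alpha\left(\sum_{i=1}^n\delta_{(x_i,y_i)}\boxtimes e_i\right)$ for all $g\in X^\#$, $\phi\in E^*$ and $\sum_i\delta_{(x_i,y_i)}\boxtimes e_i\in X\boxtimes E$. A base-point preserving map $f\colon X\to E^*$ is an $\alpha$-Lipschitz operator if there is $C\ge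 0$ with $\left|\sum_{i=1}^n\langle f(x_i)-f(y_i),e_i\rangle\right|\le C\,\alpha\left(\sum_{i=1}^n\delta_{(x_i,y_i)}\boxtimes e_i\right)$ for all $\sum_{i=1}^n\delta_{(x_i,y_i)}\boxtimes e_i\in X\boxtimes E$; the infimum of such $C$ is $\mathrm{Lip}_\alpha(f)$, and $\mathrm{Lip}_\alpha(X,E^* )$ is the set of all such maps. A Lipschitz operator Banach space from $X$ to $E^*$ is a linear subspace $B(X,E^* )$ of $\mathrm{Lip}_0(X,E^* )$ with a norm $\|\cdot\|_B$ such that: (1) $(B(X,E^* ),\|\cdot\|_B)$ is a Banach space; (2) $\|f\|_B\ge\mathrm{Lip}(f)$ for every $f\in B(X,E^* )$; (3) for every $g\in X^\#$ and $\phi\in E^*$, the map $g\cdot\phi\colon x\mapsto g(x)\phi$ belongs to $B(X,E^* )$ and $\|g\cdot\phi\|_B=\mathrm{Lip}(g)\|\phi\|$. *)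

theory Defs
  imports "HOL-Analysis.Analysis" "HOL-Library.Function_Algebras"
begin

section \<open>Banach spaces and their duals over the real or complex field\<close>

text \<open>The scalar field is a type of sort \<open>{real_normed_field, banach}\<close>. By the theorem of Gelfand and
  Mazur such a field is isometrically isomorphic to \<open>real\<close> or to \<open>complex\<close>, and both are
  instances. The class \<open>banach\<close> only knows multiplication by real scalars, so multiplication by
  elements of the scalar field is an explicit parameter that has to extend it. For \<open>real\<close> it is
  necessarily \<open>scaleR\<close>.\<close>

locale banach_space_over = vector_space smul
  for smul :: "'k::{real_normed_field,banach} \<Rightarrow> 'e::banach \<Rightarrow> 'e" +
  assumes scale_of_real: "smul (of_real r) v = r *\<^sub>R v"
    and norm_scale: "norm (smul a v) = norm a * norm v"

text \<open>Elements of \<open>'e \<Rightarrow>\<^sub>L 'k\<close> are linear over \<open>real\<close> only; the dual consists of those that are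
  linear over the scalar field. Its norm is the operator norm of that type.\<close>

definition dual ::
  "('k::{real_normed_field,banach} \<Rightarrow> 'e::banach \<Rightarrow> 'e) \<Rightarrow> ('e \<Rightarrow>\<^sub>L 'k) set" where
  "dual smul =
    {\<phi>. \<forall>a v. blinfun_apply \<phi> (smul a v) = a * blinfun_apply \<phi> v}"

definition dual_scale ::
  "'k::{real_normed_field,banach} \<Rightarrow> ('e::banach \<Rightarrow>\<^sub>L 'k) \<Rightarrow> ('e \<Rightarrow>\<^sub>L 'k)" where
  "dual_scale a \<phi> = blinfun_mult_right a o\<^sub>L \<phi>"

definition pointwise_scale :: "('k \<Rightarrow> 'v \<Rightarrow> 'v) \<Rightarrow> 'k \<Rightarrow> ('a \<Rightarrow> 'v) \<Rightarrow> ('a \<Rightarrow> 'v)" where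
  "pointwise_scale s a u = (\<lambda>t. s a (u t))"

text \<open>A norm on a linear subspace \<open>V\<close>, and completeness of \<open>V\<close> for it. Only the values of \<open>N\<close> on
  \<open>V\<close> matter.\<close>

definition norm_on ::
  "('k::real_normed_field \<Rightarrow> 'v::ab_group_add \<Rightarrow> 'v) \<Rightarrow> 'v set \<Rightarrow> ('v \<Rightarrow> real) \<Rightarrow> bool" where
  "norm_on s V N \<longleftrightarrow>
    (\<forall>u\<in>V. 0 \<le> N u) \<and>
    (\<forall>u\<in>V. N u = 0 \<longleftrightarrow> u = 0) \<and>
    (\<forall>a. \<forall>u\<in>V. N (s a u) = norm a * N u) \<and>
    (\<forall>u\<in>V. \<forall>v\<in>V. N (u + v) \<le> N u + N v)"

definition complete_norm_on :: "'v::ab_group_add set \<Rightarrow> ('v \<Rightarrow> real) \<Rightarrow> bool" where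
  "complete_norm_on V N \<longleftrightarrow>
    (\<forall>u :: nat \<Rightarrow> 'v. (\<forall>n. u n \<in> V) \<longrightarrow>
      (\<forall>\<epsilon>>0. \<exists>M. \<forall>m\<ge>M. \<forall>n\<ge>M. N (u m - u n) < \<epsilon>) \<longrightarrow>
      (\<exists>l\<in>V. (\<lambda>n. N (u n - l)) \<longlonglongrightarrow> 0))"

section \<open>Lipschitz maps\<close>

definition base_point_preserving :: "'x \<Rightarrow> 'f::zero set \<Rightarrow> ('x \<Rightarrow> 'f) set" where
  "base_point_preserving x0 F = {f. f x0 = 0 \<and> range f \<subseteq> F}"

definition Lip0 :: "'x::metric_space \<Rightarrow> 'f::real_normed_vector set \<Rightarrow> ('x \<Rightarrow> 'f) set" where
  "Lip0 x0 F = {f \<in> base_point_preserving x0 F. \<exists>C. C-lipschitz_on UNIV f}"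

definition Lip :: "('x::metric_space \<Rightarrow> 'f::real_normed_vector) \<Rightarrow> real" where
  "Lip f = Inf {C. C-lipschitz_on UNIV f}"

section \<open>The Lipschitz tensor product\<close>

text \<open>Functionals on \<open>Lip0 x0 (dual smul)\<close> are represented by total functions that vanish
  outside this set, so that equality of functions is equality of functionals.\<close>

definition elem_tensor ::
  "('k::{real_normed_field,banach} \<Rightarrow> 'e::banach \<Rightarrow> 'e) \<Rightarrow> 'x::metric_space
    \<Rightarrow> 'x \<Rightarrow> 'x \<Rightarrow> 'e \<Rightarrow> (('x \<Rightarrow> 'e \<Rightarrow>\<^sub>L 'k) \<Rightarrow> 'k)" where
  "elem_tensor smul x0 x y e =
    (\<lambda>f. if f \<in> Lip0 x0 (dual smul) then blinfun_apply (f x - f y) e else 0)"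

definition lip_tensor_product ::
  "('k::{real_normed_field,banach} \<Rightarrow> 'e::banach \<Rightarrow> 'e) \<Rightarrow> 'x::metric_space
    \<Rightarrow> (('x \<Rightarrow> 'e \<Rightarrow>\<^sub>L 'k) \<Rightarrow> 'k) set" where
  "lip_tensor_product smul x0 =
    module.span (pointwise_scale (*)) {elem_tensor smul x0 x y e | x y e. True}"

definition lipschitz_cross_norm ::
  "('k::{real_normed_field,banach} \<Rightarrow> 'e::banach \<Rightarrow> 'e) \<Rightarrow> 'x::metric_space
    \<Rightarrow> ((('x \<Rightarrow> 'e \<Rightarrow>\<^sub>L 'k) \<Rightarrow> 'k) \<Rightarrow> real) \<Rightarrow> bool" where
  "lipschitz_cross_norm smul x0 \<alpha> \<longleftrightarrow>
    norm_on (pointwise_scale (*)) (lip_tensor_product smul x0) \<alpha> \<and>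
    (\<forall>x y e. \<alpha> (elem_tensor smul x0 x y e) = dist x y * norm e)"

definition dualizable ::
  "('k::{real_normed_field,banach} \<Rightarrow> 'e::banach \<Rightarrow> 'e) \<Rightarrow> 'x::metric_space
    \<Rightarrow> ((('x \<Rightarrow> 'e \<Rightarrow>\<^sub>L 'k) \<Rightarrow> 'k) \<Rightarrow> real) \<Rightarrow> bool" where
  "dualizable smul x0 \<alpha> \<longleftrightarrow>
    (\<forall>g \<in> Lip0 x0 (UNIV :: 'k set). \<forall>\<phi> \<in> dual smul.
      \<forall>(n::nat) (x :: nat \<Rightarrow> 'x) (y :: nat \<Rightarrow> 'x) (e :: nat \<Rightarrow> 'e).
        norm (\<Sum>i<n. (g (x i) - g (y i)) * blinfun_apply \<phi> (e i))
          \<le> Lip g * norm \<phi> * \<alpha> (\<Sum>i<n. elem_tensor smul x0 (x i) (y i) (e i)))"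

section \<open>Lipschitz operators associated with a cross-norm\<close>

definition alpha_bound ::
  "('k::{real_normed_field,banach} \<Rightarrow> 'e::banach \<Rightarrow> 'e) \<Rightarrow> 'x::metric_space
    \<Rightarrow> ((('x \<Rightarrow> 'e \<Rightarrow>\<^sub>L 'k) \<Rightarrow> 'k) \<Rightarrow> real) \<Rightarrow> ('x \<Rightarrow> 'e \<Rightarrow>\<^sub>L 'k) \<Rightarrow> real \<Rightarrow> bool" where
  "alpha_bound smul x0 \<alpha> f C \<longleftrightarrow>
    0 \<le> C \<and>
    (\<forall>(n::nat) (x :: nat \<Rightarrow> 'x) (y :: nat \<Rightarrow> 'x) (e :: nat \<Rightarrow> 'e).
      norm (\<Sum>i<n. blinfun_apply (f (x i) - f (y i)) (e i))
        \<le> C * \<alpha> (\<Sum>i<n. elem_tensor smul x0 (x i) (y i) (e i)))"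

definition Lip_alpha_space ::
  "('k::{real_normed_field,banach} \<Rightarrow> 'e::banach \<Rightarrow> 'e) \<Rightarrow> 'x::metric_space
    \<Rightarrow> ((('x \<Rightarrow> 'e \<Rightarrow>\<^sub>L 'k) \<Rightarrow> 'k) \<Rightarrow> real) \<Rightarrow> ('x \<Rightarrow> 'e \<Rightarrow>\<^sub>L 'k) set" where
  "Lip_alpha_space smul x0 \<alpha> =
    {f \<in> base_point_preserving x0 (dual smul). \<exists>C. alpha_bound smul x0 \<alpha> f C}"

definition Lip_alpha ::
  "('k::{real_normed_field,banach} \<Rightarrow> 'e::banach \<Rightarrow> 'e) \<Rightarrow> 'x::metric_space
    \<Rightarrow> ((('x \<Rightarrow> 'e \<Rightarrow>\<^sub>L 'k) \<Rightarrow> 'k) \<Rightarrow> real) \<Rightarrow> ('x \<Rightarrow> 'e \<Rightarrow>\<^sub>L 'k) \<Rightarrow> real" where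
  "Lip_alpha smul x0 \<alpha> f = Inf {C. alpha_bound smul x0 \<alpha> f C}"

definition lipschitz_operator_banach_space ::
  "('k::{real_normed_field,banach} \<Rightarrow> 'e::banach \<Rightarrow> 'e) \<Rightarrow> 'x::metric_space
    \<Rightarrow> ('x \<Rightarrow> 'e \<Rightarrow>\<^sub>L 'k) set \<Rightarrow> (('x \<Rightarrow> 'e \<Rightarrow>\<^sub>L 'k) \<Rightarrow> real) \<Rightarrow> bool" where
  "lipschitz_operator_banach_space smul x0 B N \<longleftrightarrow>
    B \<subseteq> Lip0 x0 (dual smul) \<and>
    module.subspace (pointwise_scale dual_scale) B \<and>
    norm_on (pointwise_scale dual_scale) B N \<and>
    complete_norm_on B N \<and>
    (\<forall>f\<in>B. Lip f \<le> N f) \<and>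
    (\<forall>g \<in> Lip0 x0 (UNIV :: 'k set). \<forall>\<phi> \<in> dual smul.
      (\<lambda>x. dual_scale (g x) \<phi>) \<in> B \<and>
      N (\<lambda>x. dual_scale (g x) \<phi>) = Lip g * norm \<phi>)"

end

theory Submission
  imports Defs
begin

text \<open>The infimum defining \<open>Lip_alpha f\<close> is attained, so \<open>Lip_alpha f\<close> is the least constant that
  bounds the pairing of \<open>f\<close> with all tensors, and every statement about it reduces to a statement
  about bounds. Testing such a bound on a single elementary tensor, where \<open>\<alpha>\<close> is known because it is
  a cross-norm, shows that it is a Lipschitz constant of \<open>f\<close>. Hence \<open>Lip \<le> Lip_alpha\<close> and, since
  the maps vanish at the base point, a Cauchy sequence for \<open>Lip_alpha\<close> is pointwise Cauchy in the
  Banach space \<open>'e \<Rightarrow>\<^sub>L 'k\<close>, in which the dual is closed.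
  The Cauchy estimates involve only finitely many points at a time, so they pass to the pointwise
  limit, which gives completeness. The remaining requirement, on the maps
  \<open>g \<cdot> \<phi> = (\<lambda>x. dual_scale (g x) \<phi>)\<close>, is where dualizability enters.

  The pairing of \<open>g \<cdot> \<phi>\<close> with a tensor is the sum in the definition of \<open>dualizable\<close>, so \<open>\<alpha>\<close> is
  dualizable exactly when \<open>Lip g * norm \<phi>\<close> is a bound for each \<open>g \<cdot> \<phi>\<close>, that is, when each
  \<open>g \<cdot> \<phi>\<close> lies in the space and \<open>Lip_alpha (g \<cdot> \<phi>) \<le> Lip g * norm \<phi>\<close>. The reverse inequality
  is \<open>Lip \<le> Lip_alpha\<close> again, because the least Lipschitz constant of \<open>g \<cdot> \<phi>\<close> is \<open>Lip g * norm \<phi>\<close>.\<close>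

section \<open>Scalar multiplication in the dual and on function spaces\<close>

lemma dual_scale_apply [simp]: "blinfun_apply (dual_scale a \<phi>) v = a * blinfun_apply \<phi> v"
  by (simp add: dual_scale_def)

lemma norm_dual_scale: "norm (dual_scale a \<phi>) = norm a * norm \<phi>"
proof (rule antisym)
  show "norm (dual_scale a \<phi>) \<le> norm a * norm \<phi>"
    by (rule norm_blinfun_bound)
      (auto simp: norm_mult mult.assoc intro!: mult_left_mono norm_blinfun)
  show "norm a * norm \<phi> \<le> norm (dual_scale a \<phi>)"
  proof (cases "a = 0")
    case False
    have "norm (blinfun_apply \<phi> v) \<le> norm (dual_scale a \<phi>) / norm a * norm v" for v
      using norm_blinfun[of "dual_scale a \<phi>" v] False by (simp add: norm_mult field_simps)
    then have "norm \<phi> \<le> norm (dual_scale a \<phi>) / norm a"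
      by (intro norm_blinfun_bound) auto
    then show ?thesis
      using False by (simp add: field_simps)
  qed simp
qed

lemma dual_scale_diff_left: "dual_scale (a - b) \<phi> = dual_scale a \<phi> - dual_scale b \<phi>"
  by (rule blinfun_eqI) (simp add: blinfun.bilinear_simps algebra_simps)

lemma module_dual_scale: "module dual_scale"
  by unfold_locales (auto intro!: blinfun_eqI simp: blinfun.bilinear_simps algebra_simps)

lemma module_mult: "module ((*) :: 'k::field \<Rightarrow> 'k \<Rightarrow> 'k)"
  by unfold_locales (auto simp: algebra_simps)

lemma module_pointwise_scale:
  fixes s :: "'k::field \<Rightarrow> 'v::ab_group_add \<Rightarrow> 'v"
  assumes "module s"
  shows "module (pointwise_scale s :: 'k \<Rightarrow> ('a \<Rightarrow> 'v) \<Rightarrow> 'a \<Rightarrow> 'v)"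
proof -
  interpret module s by fact
  show ?thesis
    by unfold_locales (auto simp: pointwise_scale_def algebra_simps)
qed

lemma closed_dual: "closed (dual smul)"
proof -
  have "dual smul =
    (\<Inter>a. \<Inter>v. {\<phi>. blinfun_apply \<phi> (smul a v) = a * blinfun_apply \<phi> v})"
    by (auto simp: dual_def)
  then show ?thesis
    by (auto intro!: closed_INT closed_Collect_eq continuous_intros)
qed

lemma dual_zero: "0 \<in> dual smul"
  and dual_add: "\<phi> \<in> dual smul \<Longrightarrow> \<psi> \<in> dual smul \<Longrightarrow> \<phi> + \<psi> \<in> dual smul"
  and dual_diff: "\<phi> \<in> dual smul \<Longrightarrow> \<psi> \<in> dual smul \<Longrightarrow> \<phi> - \<psi> \<in> dual smul"
  and dual_scale_dual: "\<phi> \<in> dual smul \<Longrightarrow> dual_scale a \<phi> \<in> dual smul"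
  by (auto simp: dual_def blinfun.bilinear_simps algebra_simps)

section \<open>The least Lipschitz constant\<close>

lemma Lip_le: "C-lipschitz_on UNIV f \<Longrightarrow> Lip f \<le> C"
  unfolding Lip_def by (intro cInf_lower bdd_belowI[of _ 0]) (auto simp: lipschitz_on_nonneg)

lemma Lip_nonneg: "f \<in> Lip0 x0 F \<Longrightarrow> 0 \<le> Lip f"
  unfolding Lip_def Lip0_def by (intro cInf_greatest) (auto simp: lipschitz_on_nonneg)

section \<open>Lipschitz operators of a cross-norm\<close>

context
  fixes smul :: "'k::{real_normed_field,banach} \<Rightarrow> 'e::banach \<Rightarrow> 'e"
    and x0 :: "'x::metric_space"
    and \<alpha> :: "(('x \<Rightarrow> 'e \<Rightarrow>\<^sub>L 'k) \<Rightarrow> 'k) \<Rightarrow> real"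
  assumes cross: "lipschitz_cross_norm smul x0 \<alpha>"
begin

lemma cross_norm_sum_nonneg: "0 \<le> \<alpha> (\<Sum>i<(n::nat). elem_tensor smul x0 (x i) (y i) (e i))"
proof -
  interpret module "pointwise_scale (*) :: 'k \<Rightarrow> (('x \<Rightarrow> 'e \<Rightarrow>\<^sub>L 'k) \<Rightarrow> 'k) \<Rightarrow> _"
    by (intro module_pointwise_scale module_mult)
  have "(\<Sum>i<n. elem_tensor smul x0 (x i) (y i) (e i)) \<in> lip_tensor_product smul x0"
    unfolding lip_tensor_product_def by (intro span_sum span_base) auto
  then show ?thesis
    using cross by (simp add: lipschitz_cross_norm_def norm_on_def)
qed

lemma alpha_bound_elem:
  assumes "alpha_bound smul x0 \<alpha> f C"
  shows "norm (blinfun_apply (f x - f y) e) \<le> C * (dist x y * norm e)"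
proof -
  have "\<forall>x y e. norm (\<Sum>i<1::nat. blinfun_apply (f (x i) - f (y i)) (e i))
      \<le> C * \<alpha> (\<Sum>i<1::nat. elem_tensor smul x0 (x i) (y i) (e i))"
    using assms unfolding alpha_bound_def by blast
  from this[THEN spec[of _ "\<lambda>_. x"], THEN spec[of _ "\<lambda>_. y"], THEN spec[of _ "\<lambda>_. e"]]
  show ?thesis
    using cross by (simp add: lipschitz_cross_norm_def)
qed

lemma alpha_bound_lipschitz:
  assumes "alpha_bound smul x0 \<alpha> f C"
  shows "C-lipschitz_on UNIV f"
proof (rule lipschitz_onI)
  show "0 \<le> C"
    using assms by (simp add: alpha_bound_def)
  then show "dist (f x) (f y) \<le> C * dist x y" for x y
    unfolding dist_norm[of "f x"]
    using alpha_bound_elem[OF assms, of x y]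
    by (intro norm_blinfun_bound) (auto simp: mult.assoc)
qed

lemma Lip_alpha_le: "alpha_bound smul x0 \<alpha> f C \<Longrightarrow> Lip_alpha smul x0 \<alpha> f \<le> C"
  unfolding Lip_alpha_def by (intro cInf_lower bdd_belowI[of _ 0]) (auto simp: alpha_bound_def)

text \<open>Each tensor imposes a condition \<open>s \<le> C * t\<close> with \<open>t \<ge> 0\<close>, and such a condition is preserved
  by infima of the admissible \<open>C\<close>: it reads \<open>s / t \<le> C\<close> if \<open>t > 0\<close>, and does not involve \<open>C\<close> if
  \<open>t = 0\<close>.\<close>

lemma alpha_bound_Lip_alpha:
  assumes "f \<in> Lip_alpha_space smul x0 \<alpha>"
  shows "alpha_bound smul x0 \<alpha> f (Lip_alpha smul x0 \<alpha> f)"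
  unfolding alpha_bound_def
proof (intro conjI allI)
  obtain C where C: "alpha_bound smul x0 \<alpha> f C"
    using assms by (auto simp: Lip_alpha_space_def)
  show "0 \<le> Lip_alpha smul x0 \<alpha> f"
    unfolding Lip_alpha_def using C by (intro cInf_greatest) (auto simp: alpha_bound_def)
  fix n :: nat and x y :: "nat \<Rightarrow> 'x" and e :: "nat \<Rightarrow> 'e"
  let ?s = "norm (\<Sum>i<n. blinfun_apply (f (x i) - f (y i)) (e i))"
  let ?t = "\<alpha> (\<Sum>i<n. elem_tensor smul x0 (x i) (y i) (e i))"
  have le: "?s \<le> D * ?t" if "alpha_bound smul x0 \<alpha> f D" for D
    using that by (simp add: alpha_bound_def)
  show "?s \<le> Lip_alpha smul x0 \<alpha> f * ?t"
  proof (cases "?t = 0")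
    case True
    then show ?thesis using le[OF C] by simp
  next
    case False
    then have pos: "0 < ?t"
      using cross_norm_sum_nonneg[of x y e n] by linarith
    then have "?s / ?t \<le> Lip_alpha smul x0 \<alpha> f"
      unfolding Lip_alpha_def using C le by (intro cInf_greatest) (auto simp: pos_divide_le_eq)
    then show ?thesis using pos by (simp add: pos_divide_le_eq)
  qed
qed

lemma alpha_bound_mono:
  assumes "alpha_bound smul x0 \<alpha> f C" "C \<le> D"
  shows "alpha_bound smul x0 \<alpha> f D"
  using assms
  by (auto simp: alpha_bound_def
      intro: order_trans[OF _ mult_right_mono[OF \<open>C \<le> D\<close> cross_norm_sum_nonneg]])

lemma alpha_bound_zero: "alpha_bound smul x0 \<alpha> 0 0"
  by (simp add: alpha_bound_def)

lemma alpha_bound_add: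
  assumes f: "alpha_bound smul x0 \<alpha> f C" and g: "alpha_bound smul x0 \<alpha> g D"
  shows "alpha_bound smul x0 \<alpha> (f + g) (C + D)"
  unfolding alpha_bound_def
proof (intro conjI allI)
  show "0 \<le> C + D" using f g by (simp add: alpha_bound_def)
  fix n :: nat and x y :: "nat \<Rightarrow> 'x" and e :: "nat \<Rightarrow> 'e"
  let ?p = "\<lambda>h. \<Sum>i<n. blinfun_apply (h (x i) - h (y i)) (e i)"
  let ?t = "\<alpha> (\<Sum>i<n. elem_tensor smul x0 (x i) (y i) (e i))"
  have "?p (f + g) = ?p f + ?p g"
    by (simp add: blinfun.bilinear_simps sum.distrib sum_subtractf)
  also have "norm \<dots> \<le> norm (?p f) + norm (?p g)"
    by (rule norm_triangle_ineq)
  also have "\<dots> \<le> C * ?t + D * ?t"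
    using f g by (intro add_mono) (auto simp: alpha_bound_def)
  finally show "norm (?p (f + g)) \<le> (C + D) * ?t"
    by (simp add: distrib_right)
qed

lemma alpha_bound_scale:
  assumes f: "alpha_bound smul x0 \<alpha> f C"
  shows "alpha_bound smul x0 \<alpha> (pointwise_scale dual_scale a f) (norm a * C)"
  unfolding alpha_bound_def
proof (intro conjI allI)
  show "0 \<le> norm a * C" using f by (simp add: alpha_bound_def)
  fix n :: nat and x y :: "nat \<Rightarrow> 'x" and e :: "nat \<Rightarrow> 'e"
  let ?p = "\<lambda>h. \<Sum>i<n. blinfun_apply (h (x i) - h (y i)) (e i)"
  let ?t = "\<alpha> (\<Sum>i<n. elem_tensor smul x0 (x i) (y i) (e i))"
  have "?p (pointwise_scale dual_scale a f) = a * ?p f"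
    by (simp add: pointwise_scale_def blinfun.bilinear_simps sum_distrib_left right_diff_distrib)
  moreover have "norm (?p f) \<le> C * ?t"
    using f by (simp add: alpha_bound_def)
  ultimately show "norm (?p (pointwise_scale dual_scale a f)) \<le> norm a * C * ?t"
    by (simp add: norm_mult mult.assoc mult_left_mono)
qed

text \<open>Each condition involves finitely many values of the map, so pointwise convergence suffices.\<close>

lemma alpha_bound_limit:
  assumes bound: "\<forall>\<^sub>F n in sequentially. alpha_bound smul x0 \<alpha> (u n) C"
    and lim: "\<And>t. (\<lambda>n. u n t) \<longlonglongrightarrow> l t"
  shows "alpha_bound smul x0 \<alpha> l C"
  unfolding alpha_bound_def
proof (intro conjI allI)
  show "0 \<le> C"
    using eventually_happens[OF bound] by (auto simp: alpha_bound_def)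
  fix n :: nat and x y :: "nat \<Rightarrow> 'x" and e :: "nat \<Rightarrow> 'e"
  let ?p = "\<lambda>h. \<Sum>i<n. blinfun_apply (h (x i) - h (y i)) (e i)"
  have "(\<lambda>m. norm (?p (u m))) \<longlonglongrightarrow> norm (?p l)"
    by (intro tendsto_intros lim)
  then show "norm (?p l) \<le> C * \<alpha> (\<Sum>i<n. elem_tensor smul x0 (x i) (y i) (e i))"
    by (rule tendsto_upperbound) (use bound in \<open>auto simp: alpha_bound_def elim: eventually_mono\<close>)
qed

lemma Lip_alpha_space_subset_Lip0: "Lip_alpha_space smul x0 \<alpha> \<subseteq> Lip0 x0 (dual smul)"
  using alpha_bound_lipschitz by (auto simp: Lip_alpha_space_def Lip0_def)

lemma Lip_le_Lip_alpha:
  "f \<in> Lip_alpha_space smul x0 \<alpha> \<Longrightarrow> Lip f \<le> Lip_alpha smul x0 \<alpha> f"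
  by (intro Lip_le alpha_bound_lipschitz alpha_bound_Lip_alpha)

lemma zero_in_Lip_alpha_space: "0 \<in> Lip_alpha_space smul x0 \<alpha>"
  using alpha_bound_zero dual_zero
  by (auto simp: Lip_alpha_space_def base_point_preserving_def)

lemma add_in_Lip_alpha_space:
  assumes "f \<in> Lip_alpha_space smul x0 \<alpha>" "g \<in> Lip_alpha_space smul x0 \<alpha>"
  shows "f + g \<in> Lip_alpha_space smul x0 \<alpha>"
  using assms alpha_bound_add dual_add
  by (fastforce simp: Lip_alpha_space_def base_point_preserving_def image_subset_iff)

lemma scale_in_Lip_alpha_space:
  assumes "f \<in> Lip_alpha_space smul x0 \<alpha>"
  shows "pointwise_scale dual_scale a f \<in> Lip_alpha_space smul x0 \<alpha>"
proof -
  have "dual_scale a (0 :: 'e \<Rightarrow>\<^sub>L 'k) = 0"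
    by (rule module.scale_zero_right[OF module_dual_scale])
  moreover have "\<exists>C. alpha_bound smul x0 \<alpha> (pointwise_scale dual_scale a f) C"
    using alpha_bound_scale[OF alpha_bound_Lip_alpha[OF assms]] by blast
  ultimately show ?thesis
    using assms dual_scale_dual
    by (auto simp: Lip_alpha_space_def base_point_preserving_def image_subset_iff
        pointwise_scale_def)
qed

lemma subspace_Lip_alpha_space:
  "module.subspace (pointwise_scale dual_scale) (Lip_alpha_space smul x0 \<alpha>)"
  using zero_in_Lip_alpha_space add_in_Lip_alpha_space scale_in_Lip_alpha_space
  by (auto simp: module.subspace_def[OF module_pointwise_scale[OF module_dual_scale]])

lemma diff_in_Lip_alpha_space:
  assumes "f \<in> Lip_alpha_space smul x0 \<alpha>" "g \<in> Lip_alpha_space smul x0 \<alpha>"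
  shows "f - g \<in> Lip_alpha_space smul x0 \<alpha>"
  by (rule module.subspace_diff[OF module_pointwise_scale[OF module_dual_scale]
        subspace_Lip_alpha_space assms])

lemma norm_le_Lip_alpha:
  assumes "f \<in> Lip_alpha_space smul x0 \<alpha>"
  shows "norm (f t) \<le> Lip_alpha smul x0 \<alpha> f * dist t x0"
  using lipschitz_onD[OF alpha_bound_lipschitz[OF alpha_bound_Lip_alpha[OF assms]], of t x0] assms
  by (simp add: Lip_alpha_space_def base_point_preserving_def)

lemma Lip_alpha_scale_le:
  assumes "f \<in> Lip_alpha_space smul x0 \<alpha>"
  shows "Lip_alpha smul x0 \<alpha> (pointwise_scale dual_scale a f) \<le> norm a * Lip_alpha smul x0 \<alpha> f"
  using Lip_alpha_le[OF alpha_bound_scale[OF alpha_bound_Lip_alpha[OF assms]]] .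

lemma norm_on_Lip_alpha:
  "norm_on (pointwise_scale dual_scale) (Lip_alpha_space smul x0 \<alpha>) (Lip_alpha smul x0 \<alpha>)"
proof -
  let ?V = "Lip_alpha_space smul x0 \<alpha>" and ?N = "Lip_alpha smul x0 \<alpha>"
  let ?s = "pointwise_scale dual_scale :: 'k \<Rightarrow> ('x \<Rightarrow> 'e \<Rightarrow>\<^sub>L 'k) \<Rightarrow> _"
  interpret module ?s by (intro module_pointwise_scale module_dual_scale)
  have nonneg: "0 \<le> ?N u" if "u \<in> ?V" for u
    using alpha_bound_Lip_alpha[OF that] by (simp add: alpha_bound_def)
  have zero: "?N 0 = 0"
    using Lip_alpha_le[OF alpha_bound_zero] nonneg[OF zero_in_Lip_alpha_space] by linarith
  have definite: "u = 0" if "u \<in> ?V" "?N u = 0" for u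
    using norm_le_Lip_alpha[OF that(1)] that(2) by (auto simp: fun_eq_iff)
  have homogeneous: "?N (?s a u) = norm a * ?N u" if u: "u \<in> ?V" for a u
  proof (cases "a = 0")
    case True
    then show ?thesis by (simp add: zero)
  next
    case False
    \<comment> \<open>The reverse inequality is the estimate for the inverse scalar, applied to \<open>a u\<close>.\<close>
    have "?N (?s (inverse a) (?s a u)) \<le> norm (inverse a) * ?N (?s a u)"
      by (intro Lip_alpha_scale_le scale_in_Lip_alpha_space u)
    then have "norm a * ?N u \<le> ?N (?s a u)"
      using False by (simp add: norm_divide field_simps)
    then show ?thesis
      using Lip_alpha_scale_le[OF u] by (intro antisym) auto
  qed
  have triangle: "?N (u + v) \<le> ?N u + ?N v" if "u \<in> ?V" "v \<in> ?V" for u v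
    by (intro Lip_alpha_le alpha_bound_add alpha_bound_Lip_alpha that)
  show ?thesis
    using nonneg zero definite homogeneous triangle unfolding norm_on_def by blast
qed

lemma complete_norm_on_Lip_alpha:
  "complete_norm_on (Lip_alpha_space smul x0 \<alpha>) (Lip_alpha smul x0 \<alpha>)"
  unfolding complete_norm_on_def
proof (intro allI impI)
  let ?V = "Lip_alpha_space smul x0 \<alpha>" and ?N = "Lip_alpha smul x0 \<alpha>"
  fix u :: "nat \<Rightarrow> 'x \<Rightarrow> 'e \<Rightarrow>\<^sub>L 'k"
  assume "\<forall>n. u n \<in> ?V"
  then have u: "u n \<in> ?V" for n by blast
  assume cauchy: "\<forall>\<epsilon>>0. \<exists>M. \<forall>m\<ge>M. \<forall>n\<ge>M. ?N (u m - u n) < \<epsilon>"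
  have "Cauchy (\<lambda>n. u n t)" for t
  proof (rule CauchyI)
    fix \<epsilon> :: real assume "0 < \<epsilon>"
    \<comment> \<open>The summand 1 keeps the divisor positive when \<open>t\<close> is the base point.\<close>
    then have "0 < \<epsilon> / (dist t x0 + 1)"
      by (simp add: add_nonneg_pos)
    then obtain M where M: "\<And>m n. m \<ge> M \<Longrightarrow> n \<ge> M \<Longrightarrow> ?N (u m - u n) < \<epsilon> / (dist t x0 + 1)"
      using cauchy by blast
    have "norm (u m t - u n t) < \<epsilon>" if "m \<ge> M" "n \<ge> M" for m n
    proof -
      have "norm (u m t - u n t) \<le> ?N (u m - u n) * dist t x0"
        using norm_le_Lip_alpha[OF diff_in_Lip_alpha_space[OF u u]] by simp
      also have "\<dots> \<le> \<epsilon> / (dist t x0 + 1) * dist t x0"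
        using M[OF that] by (intro mult_right_mono) auto
      also have "\<dots> < \<epsilon>"
        using \<open>0 < \<epsilon>\<close> add_nonneg_pos[OF zero_le_dist[of t x0] zero_less_one]
        by (simp add: pos_divide_less_eq)
      finally show ?thesis .
    qed
    then show "\<exists>M. \<forall>m\<ge>M. \<forall>n\<ge>M. norm (u m t - u n t) < \<epsilon>" by blast
  qed
  then have "\<forall>t. \<exists>L. (\<lambda>n. u n t) \<longlonglongrightarrow> L"
    by (simp add: Cauchy_convergent_iff convergent_def)
  then obtain l where lim: "\<And>t. (\<lambda>n. u n t) \<longlonglongrightarrow> l t"
    by metis
  have base: "l \<in> base_point_preserving x0 (dual smul)"
  proof -
    have "u n x0 = 0" "u n t \<in> dual smul" for n t
      using u[of n] by (auto simp: Lip_alpha_space_def base_point_preserving_def)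
    then have "l x0 = 0" "l t \<in> dual smul" for t
      using lim[of x0] LIMSEQ_unique[OF _ tendsto_const]
        closed_sequentially[OF closed_dual _ lim] by auto
    then show ?thesis
      by (auto simp: base_point_preserving_def)
  qed
  \<comment> \<open>Fix \<open>n\<close> in the Cauchy estimate and let the other index tend to infinity.\<close>
  have near: "\<exists>M. \<forall>n\<ge>M. alpha_bound smul x0 \<alpha> (u n - l) \<epsilon>" if pos: "0 < \<epsilon>" for \<epsilon>
  proof -
    obtain M where M: "\<And>m n. m \<ge> M \<Longrightarrow> n \<ge> M \<Longrightarrow> ?N (u m - u n) < \<epsilon>"
      using cauchy pos by blast
    have "alpha_bound smul x0 \<alpha> (u n - l) \<epsilon>" if n: "n \<ge> M" for n
    proof (rule alpha_bound_limit)
      have "alpha_bound smul x0 \<alpha> (u n - u m) \<epsilon>" if "m \<ge> M" for m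
      proof -
        have "alpha_bound smul x0 \<alpha> (u n - u m) (?N (u n - u m))"
          by (intro alpha_bound_Lip_alpha diff_in_Lip_alpha_space u)
        then show ?thesis
          by (rule alpha_bound_mono) (use M[OF n that] in simp)
      qed
      then show "\<forall>\<^sub>F m in sequentially. alpha_bound smul x0 \<alpha> (u n - u m) \<epsilon>"
        by (auto simp: eventually_sequentially)
      show "(\<lambda>m. (u n - u m) t) \<longlonglongrightarrow> (u n - l) t" for t
        using tendsto_diff[OF tendsto_const lim] by simp
    qed
    then show ?thesis by blast
  qed
  \<comment> \<open>\<open>l\<close> differs from a member of the sequence by a map that has a bound.\<close>
  have l: "l \<in> ?V"
  proof -
    obtain M where "alpha_bound smul x0 \<alpha> (u M - l) 1"
      using near[of 1] by auto
    then have "u M - l \<in> ?V"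
      using base u[of M]
      by (auto simp: Lip_alpha_space_def base_point_preserving_def image_subset_iff
          intro!: dual_diff)
    from diff_in_Lip_alpha_space[OF u[of M] this] show ?thesis by simp
  qed
  have "(\<lambda>n. ?N (u n - l)) \<longlonglongrightarrow> 0"
  proof (rule LIMSEQ_I)
    fix \<epsilon> :: real assume "0 < \<epsilon>"
    then obtain M where M: "\<And>n. n \<ge> M \<Longrightarrow> alpha_bound smul x0 \<alpha> (u n - l) (\<epsilon> / 2)"
      using near[of "\<epsilon> / 2"] by auto
    have "norm (?N (u n - l) - 0) < \<epsilon>" if "n \<ge> M" for n
      using Lip_alpha_le[OF M[OF that]] \<open>0 < \<epsilon>\<close>
        alpha_bound_Lip_alpha[OF diff_in_Lip_alpha_space[OF u[of n] l]]
      by (simp add: alpha_bound_def)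
    then show "\<exists>M. \<forall>n\<ge>M. norm (?N (u n - l) - 0) < \<epsilon>" by blast
  qed
  with l show "\<exists>l\<in>?V. (\<lambda>n. ?N (u n - l)) \<longlonglongrightarrow> 0" by blast
qed

section \<open>Maps of rank one and dualizability\<close>

text \<open>The pairing of \<open>g \<cdot> \<phi>\<close> with an elementary tensor is \<open>(g x - g y) * \<phi> e\<close>, so the inequality in
  \<open>dualizable\<close> is literally a bound for \<open>g \<cdot> \<phi>\<close>.\<close>

lemma dualizable_iff_alpha_bound:
  "dualizable smul x0 \<alpha> \<longleftrightarrow>
    (\<forall>g \<in> Lip0 x0 (UNIV :: 'k set). \<forall>\<phi> \<in> dual smul.
      alpha_bound smul x0 \<alpha> (\<lambda>x. dual_scale (g x) \<phi>) (Lip g * norm \<phi>))"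
  by (simp add: dualizable_def alpha_bound_def Lip_nonneg flip: dual_scale_diff_left)

text \<open>The operator norm is multiplicative on scalar multiples, so for \<open>\<phi> \<noteq> 0\<close> a Lipschitz constant of
  \<open>g \<cdot> \<phi>\<close> divided by \<open>norm \<phi>\<close> is one of \<open>g\<close>.\<close>

lemma Lip_mult_norm_le:
  fixes g :: "'x \<Rightarrow> 'k"
  assumes "C-lipschitz_on UNIV (\<lambda>x. dual_scale (g x) \<phi>)"
  shows "Lip g * norm \<phi> \<le> C"
proof (cases "\<phi> = 0")
  case True
  then show ?thesis using lipschitz_on_nonneg[OF assms] by simp
next
  case False
  have "norm (g x - g y) * norm \<phi> \<le> C * dist x y" for x y
    using lipschitz_onD[OF assms, of x y]
    by (simp add: dist_norm[of "dual_scale _ _"] norm_dual_scale flip: dual_scale_diff_left)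
  then have "(C / norm \<phi>)-lipschitz_on UNIV g"
    using False lipschitz_on_nonneg[OF assms]
    by (intro lipschitz_onI) (auto simp: dist_norm[of "g _"] field_simps)
  from Lip_le[OF this] show ?thesis
    using False by (simp add: field_simps)
qed

lemma rank_one_in_Lip_alpha_space:
  fixes g :: "'x \<Rightarrow> 'k"
  assumes "g \<in> Lip0 x0 UNIV" "\<phi> \<in> dual smul"
    and "alpha_bound smul x0 \<alpha> (\<lambda>x. dual_scale (g x) \<phi>) C"
  shows "(\<lambda>x. dual_scale (g x) \<phi>) \<in> Lip_alpha_space smul x0 \<alpha>"
proof -
  have "dual_scale (g x0) \<phi> = 0"
    using assms(1) module.scale_zero_left[OF module_dual_scale]
    by (simp add: Lip0_def base_point_preserving_def)
  then show ?thesis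
    using assms dual_scale_dual by (auto simp: Lip_alpha_space_def base_point_preserving_def)
qed

text \<open>Every bound of \<open>g \<cdot> \<phi>\<close> is one of its Lipschitz constants, hence at least \<open>Lip g * norm \<phi>\<close>.
  So the equality demanded of a Lipschitz operator Banach space says only that \<open>Lip g * norm \<phi>\<close> is
  itself a bound.\<close>

lemma rank_one_iff_alpha_bound:
  fixes g :: "'x \<Rightarrow> 'k"
  assumes "g \<in> Lip0 x0 UNIV" "\<phi> \<in> dual smul"
  shows "(\<lambda>x. dual_scale (g x) \<phi>) \<in> Lip_alpha_space smul x0 \<alpha> \<and>
      Lip_alpha smul x0 \<alpha> (\<lambda>x. dual_scale (g x) \<phi>) = Lip g * norm \<phi>
    \<longleftrightarrow> alpha_bound smul x0 \<alpha> (\<lambda>x. dual_scale (g x) \<phi>) (Lip g * norm \<phi>)"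
    (is "?f \<in> ?V \<and> ?N ?f = ?c \<longleftrightarrow> ?b")
proof
  assume "?f \<in> ?V \<and> ?N ?f = ?c"
  then show ?b using alpha_bound_Lip_alpha[of ?f] by simp
next
  assume b: ?b
  have f: "?f \<in> ?V"
    by (rule rank_one_in_Lip_alpha_space[OF assms b])
  moreover have "?N ?f = ?c"
    using Lip_alpha_le[OF b] Lip_mult_norm_le[OF alpha_bound_lipschitz[OF alpha_bound_Lip_alpha[OF f]]]
    by (rule antisym)
  ultimately show "?f \<in> ?V \<and> ?N ?f = ?c" ..
qed

end

theorem theorem6p2:
  fixes smul :: "'k::{real_normed_field,banach} \<Rightarrow> 'e::banach \<Rightarrow> 'e"
    and x0 :: "'x::metric_space"
    and \<alpha> :: "(('x \<Rightarrow> 'e \<Rightarrow>\<^sub>L 'k) \<Rightarrow> 'k) \<Rightarrow> real"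
  assumes "banach_space_over smul"
    and "lipschitz_cross_norm smul x0 \<alpha>"
  shows "lipschitz_operator_banach_space smul x0
           (Lip_alpha_space smul x0 \<alpha>) (Lip_alpha smul x0 \<alpha>)
         \<longleftrightarrow> dualizable smul x0 \<alpha>"
  unfolding lipschitz_operator_banach_space_def dualizable_iff_alpha_bound[OF assms(2)]
  using Lip_alpha_space_subset_Lip0[OF assms(2)] subspace_Lip_alpha_space[OF assms(2)]
    norm_on_Lip_alpha[OF assms(2)] complete_norm_on_Lip_alpha[OF assms(2)]
    Lip_le_Lip_alpha[OF assms(2)] rank_one_iff_alpha_bound[OF assms(2)]
  by simp

end
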